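(* Let $\mathcal{G}$ be a temporal graph whose underlying graph is a tree. Suppose a root $r$ can be chosen such that, for every vertex $v$, the edges incident to $v$ are active strictly before all other edges in the subtree rooted at $v$. Then $\mathcal{G}$ has a TIM decomposition of width $\max_t\max_v\deg_{G'_t}(v)+1$, where $G'_t$ is the snapshot at time $t$ of the temporal graph $\mathcal{G}'$ obtained from $\mathcal{G}$ by adding the time-edge $(uv,t)$ for all vertices $u,v$ and times $t$ for which there exist times $t_1<t<t_2$ with $(uv,t_1)$ and $(uv,t_2)$ time-edges of $\mathcal{G}$.
   Context: A temporal graph $\mathcal{G}=(G,\lambda)$: static (underlying) graph $G=(V,E)$ and $\lambda:E\to 2^{\mathbb{N}}$; time-edges $(e,t)$ with $t\in\lambda(e)$; an edge is active at times $\lambda(e)$; snapshot $G_t=(V,\{e:t\in\lambda(e)\})$; lifetime $\Lambda=\max_e\max\lambda(e)$. TIM decomposition: triple $(T,B,\tau)$, $T$ a directed tree, bags $B(s)\subseteq V$, $\tau$ assigning each bag a time in $[\Lambda]$, such that (1) each vertex $v$ and time $t\in[\Lambda]$ lies in exactly one bag labelled $t$; (2) each time-edge $(uv,t)$ has a unique node $i$ with $\{u,v\}\subseteq B(i)$, $\tau(B(i))=t$; (3) arcs of $T$ are exactly the pairs $(i,j)$ with $B(i)\cap B(j)\neq\emptyset$ and $\tau(B(j))=\tau(B(i))+1$. Width is the maximum bag size. *)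

theory Defs
  imports Main
begin

text \<open>Finite simple undirected graphs. The predicate \<open>tree\<close> of the AFP entry Graph_Theory only
  excludes directed cycles, so it does not express undirected trees or their orientations.\<close>

record 'a ugraph =
  verts :: "'a set"
  edges :: "'a set set"

definition simple_graph :: "('a, 'b) ugraph_scheme \<Rightarrow> bool" where
  "simple_graph G \<longleftrightarrow> finite (verts G) \<and> (\<forall>e\<in>edges G. e \<subseteq> verts G \<and> card e = 2)"

definition walk :: "('a, 'b) ugraph_scheme \<Rightarrow> 'a list \<Rightarrow> bool" where
  "walk G p \<longleftrightarrow> p \<noteq> [] \<and> set p \<subseteq> verts G \<and> successively (\<lambda>x y. {x, y} \<in> edges G) p"

definition path :: "('a, 'b) ugraph_scheme \<Rightarrow> 'a \<Rightarrow> 'a list \<Rightarrow> 'a \<Rightarrow> bool" where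
  "path G u p v \<longleftrightarrow> walk G p \<and> distinct p \<and> hd p = u \<and> last p = v"

definition connected_graph :: "('a, 'b) ugraph_scheme \<Rightarrow> bool" where
  "connected_graph G \<longleftrightarrow> verts G \<noteq> {} \<and> (\<forall>u\<in>verts G. \<forall>v\<in>verts G. \<exists>p. path G u p v)"

definition cycle :: "('a, 'b) ugraph_scheme \<Rightarrow> 'a list \<Rightarrow> bool" where
  "cycle G p \<longleftrightarrow> walk G p \<and> distinct p \<and> length p \<ge> 3 \<and> {last p, hd p} \<in> edges G"

definition is_tree :: "('a, 'b) ugraph_scheme \<Rightarrow> bool" where
  "is_tree G \<longleftrightarrow> simple_graph G \<and> connected_graph G \<and> (\<nexists>p. cycle G p)"

definition degree :: "('a, 'b) ugraph_scheme \<Rightarrow> 'a \<Rightarrow> nat" where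
  "degree G v = card {e \<in> edges G. v \<in> e}"

definition subtree_verts :: "('a, 'b) ugraph_scheme \<Rightarrow> 'a \<Rightarrow> 'a \<Rightarrow> 'a set" where
  "subtree_verts G r v = {w. \<exists>p. path G r p w \<and> v \<in> set p}"

definition subtree_edges :: "('a, 'b) ugraph_scheme \<Rightarrow> 'a \<Rightarrow> 'a \<Rightarrow> 'a set set" where
  "subtree_edges G r v = {e \<in> edges G. e \<subseteq> subtree_verts G r v}"


record 'a tgraph = "'a ugraph" +
  label :: "'a set \<Rightarrow> nat set"

text \<open>The requirements beyond \<open>simple_graph\<close> are those that make the lifetime, the maximum over all
  edges \<open>e\<close> of the maximum of \<open>label e\<close>, exist; times are positive since they are to lie in
  \<open>{1..lifetime G}\<close>.\<close>

definition temporal_graph :: "('a, 'b) tgraph_scheme \<Rightarrow> bool" where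
  "temporal_graph G \<longleftrightarrow> simple_graph G \<and> edges G \<noteq> {} \<and>
     (\<forall>e\<in>edges G. finite (label G e) \<and> label G e \<noteq> {} \<and> 0 \<notin> label G e)"

definition time_edge :: "('a, 'b) tgraph_scheme \<Rightarrow> 'a set \<Rightarrow> nat \<Rightarrow> bool" where
  "time_edge G e t \<longleftrightarrow> e \<in> edges G \<and> t \<in> label G e"

definition lifetime :: "('a, 'b) tgraph_scheme \<Rightarrow> nat" where
  "lifetime G = (MAX e\<in>edges G. Max (label G e))"

definition snapshot :: "('a, 'b) tgraph_scheme \<Rightarrow> nat \<Rightarrow> 'a ugraph" where
  "snapshot G t = \<lparr>verts = verts G, edges = {e. time_edge G e t}\<rparr>"

text \<open>The temporal graph \<open>G'\<close>. Only edges of \<open>G\<close> receive new times, so the underlying graph is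
  unchanged.\<close>

definition fill_gaps :: "'a tgraph \<Rightarrow> 'a tgraph" where
  "fill_gaps G = G\<lparr>label := \<lambda>e. label G e \<union>
     {t. \<exists>t1 t2. t1 < t \<and> t < t2 \<and> time_edge G e t1 \<and> time_edge G e t2}\<rparr>"

definition incident_edges_first :: "('a, 'b) tgraph_scheme \<Rightarrow> 'a \<Rightarrow> bool" where
  "incident_edges_first G r \<longleftrightarrow>
     (\<forall>v\<in>verts G. \<forall>e\<in>edges G. \<forall>f\<in>subtree_edges G r v. v \<in> e \<and> v \<notin> f \<longrightarrow>
        (\<forall>s\<in>label G e. \<forall>t\<in>label G f. s < t))"


text \<open>Times are attached to the nodes, as distinct nodes may carry equal bags.\<close>

record ('n, 'a) tim =
  nodes :: "'n set"
  arcs :: "('n \<times> 'n) set"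
  bag :: "'n \<Rightarrow> 'a set"
  time :: "'n \<Rightarrow> nat"

text \<open>A directed tree is an orientation of an undirected tree; the disjointness condition excludes
  antiparallel arcs, which would become a single undirected edge.\<close>

definition directed_tree :: "'n set \<Rightarrow> ('n \<times> 'n) set \<Rightarrow> bool" where
  "directed_tree N A \<longleftrightarrow> A \<inter> A\<inverse> = {} \<and>
     is_tree \<lparr>verts = N, edges = {{i, j} |i j. (i, j) \<in> A}\<rparr>"

definition tim_decomposition :: "('a, 'b) tgraph_scheme \<Rightarrow> ('n, 'a) tim \<Rightarrow> bool" where
  "tim_decomposition G D \<longleftrightarrow>
     directed_tree (nodes D) (arcs D) \<and>
     (\<forall>i\<in>nodes D. bag D i \<subseteq> verts G \<and> time D i \<in> {1..lifetime G}) \<and>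
     (\<forall>v\<in>verts G. \<forall>t\<in>{1..lifetime G}. \<exists>!i. i \<in> nodes D \<and> v \<in> bag D i \<and> time D i = t) \<and>
     (\<forall>u v t. time_edge G {u, v} t \<longrightarrow>
        (\<exists>!i. i \<in> nodes D \<and> {u, v} \<subseteq> bag D i \<and> time D i = t)) \<and>
     arcs D = {(i, j). i \<in> nodes D \<and> j \<in> nodes D \<and>
        bag D i \<inter> bag D j \<noteq> {} \<and> time D j = time D i + 1}"

definition tim_width :: "('n, 'a) tim \<Rightarrow> nat" where
  "tim_width D = (MAX i\<in>nodes D. card (bag D i))"

end

theory Submission
  imports Defs
begin

text \<open>Root the tree at \<open>r\<close>. By hypothesis the interval of times spanned by the edge from a vertex to
  its parent lies strictly before those of the edges to its children, so in every snapshot of \<open>G'\<close>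
  each component is a star consisting of a vertex and some of its children; these components are
  the bags. Each edge is present during a single interval, so the resulting graph of bags is a tree:
  from a bag whose centre \<open>v\<close> is not the root, follow \<open>v\<close> in time towards the interval in which it is
  joined to its parent; from a bag with centre \<open>r\<close>, follow \<open>r\<close> back to time 1. Each step keeps
  the centre and comes closer to that goal or reaches a bag with a centre of smaller depth, so this
  is a parent function on the bags, and all adjacencies between bags arise from it.\<close>

section \<open>Walks and trees\<close>

text \<open>Cutting out the piece between two occurrences of the same vertex shortens the walk and
  keeps both ends, so repeating this removes all repetitions.\<close>

lemma walk_imp_path:
  assumes "walk G p"
  shows "\<exists>q. path G (hd p) q (last p) \<and> set q \<subseteq> set p"
  using assms
proof (induction "length p" arbitrary: p rule: less_induct)
  case less
  show ?case
  proof (cases "distinct p")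
    case True
    then show ?thesis using less.prems by (auto simp: path_def)
  next
    case False
    then obtain xs ys zs y where p: "p = xs @ [y] @ ys @ [y] @ zs"
      using not_distinct_decomp by blast
    let ?q = "xs @ [y] @ zs"
    have w: "walk G ?q"
      using less.prems unfolding p walk_def
      by (auto simp: successively_append_iff successively_Cons split: if_splits)
    have "length ?q < length p" by (simp add: p)
    from less.hyps[OF this w] obtain q
      where "path G (hd ?q) q (last ?q)" "set q \<subseteq> set ?q" by blast
    moreover have "hd ?q = hd p" "last ?q = last p" "set ?q \<subseteq> set p"
      by (auto simp: p hd_append)
    ultimately show ?thesis by auto
  qed
qed

lemma walk_rev: "walk G p \<Longrightarrow> walk G (rev p)"
  by (simp add: walk_def insert_commute)

lemma walk_join:
  assumes "walk G p" "walk G q" "last p = hd q"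
  shows "walk G (p @ tl q)" "hd (p @ tl q) = hd p" "last (p @ tl q) = last q"
proof -
  obtain x xs where q: "q = x # xs" using assms(2) by (cases q) (auto simp: walk_def)
  show "walk G (p @ tl q)"
    using assms unfolding q walk_def
    by (auto simp: successively_append_iff successively_Cons)
  show "hd (p @ tl q) = hd p" using assms(1) by (auto simp: walk_def)
  show "last (p @ tl q) = last q"
    using assms(3) by (auto simp: q)
qed

text \<open>Criterion applied later to the graph of bags. Following \<open>par\<close> lowers
  \<open>rank\<close> and so must end in \<open>z\<close>, which gives connectedness; strict
  decrease along every edge excludes cycles.\<close>

lemma is_tree_parentI:
  fixes rank :: "'n \<Rightarrow> nat"
  assumes fin: "finite N" and z: "z \<in> N"
    and par: "\<And>i. i \<in> N \<Longrightarrow> i \<noteq> z \<Longrightarrow> par i \<in> N \<and> rank (par i) < rank i"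
    and E: "E = {{i, par i} |i. i \<in> N \<and> i \<noteq> z}"
  shows "is_tree \<lparr>verts = N, edges = E\<rparr>"
proof -
  let ?T = "\<lparr>verts = N, edges = E\<rparr>"
  have simple: "simple_graph ?T"
    unfolding simple_graph_def
  proof (intro conjI ballI)
    fix e assume "e \<in> edges ?T"
    then obtain i where i: "e = {i, par i}" "i \<in> N" "i \<noteq> z" by (auto simp: E)
    with par[OF i(2,3)] show "e \<subseteq> verts ?T" "card e = 2"
      by (auto simp: card_insert_if)
  qed (simp add: fin)
  have to_root: "\<exists>p. walk ?T p \<and> hd p = i \<and> last p = z" if "i \<in> N" for i
    using that
  proof (induction "rank i" arbitrary: i rule: less_induct)
    case less
    show ?case
    proof (cases "i = z")
      case True
      then show ?thesis using z by (intro exI[of _ "[z]"]) (auto simp: walk_def)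
    next
      case False
      then have pi: "par i \<in> N" "rank (par i) < rank i" using par less.prems by auto
      from less.hyps[OF pi(2,1)] obtain p where p: "walk ?T p" "hd p = par i" "last p = z"
        by blast
      have "{i, par i} \<in> E" using E False less.prems by blast
      then have "walk ?T (i # p)"
        using p less.prems by (auto simp: walk_def successively_Cons)
      then show ?thesis using p by (intro exI[of _ "i # p"]) (auto simp: walk_def)
    qed
  qed
  have "\<exists>p. path ?T u p v" if uv: "u \<in> N" "v \<in> N" for u v
  proof -
    obtain p where p: "walk ?T p" "hd p = u" "last p = z" using to_root uv by blast
    obtain q where q: "walk ?T q" "hd q = v" "last q = z" using to_root uv by blast
    have q': "walk ?T (rev q)" "hd (rev q) = z" "last (rev q) = v"
      using walk_rev[OF q(1)] q by (auto simp: hd_rev last_rev walk_def)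
    show ?thesis
      using walk_imp_path[OF walk_join(1)[OF p(1) q'(1)]] walk_join(2,3)[OF p(1) q'(1)] p q'
      by auto
  qed
  then have conn: "connected_graph ?T" using z by (auto simp: connected_graph_def)
  \<comment> \<open>Every edge joins some vertex to its parent, which has strictly smaller rank, so
    the end of no larger rank is the parent.\<close>
  have lower: "y = par x" if "{x, y} \<in> E" "rank y \<le> rank x" for x y
  proof -
    obtain i where i: "{x, y} = {i, par i}" "i \<in> N" "i \<noteq> z"
      using \<open>{x, y} \<in> E\<close> unfolding E by blast
    have "rank (par i) < rank i" using par i by blast
    moreover have "x = i \<and> y = par i \<or> x = par i \<and> y = i"
      using i(1) by (simp add: doubleton_eq_iff)
    ultimately show ?thesis using \<open>rank y \<le> rank x\<close> by auto
  qed
  \<comment> \<open>A vertex of maximal rank on a cycle would have its parent as both neighbours.\<close>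
  have "\<not> cycle ?T p" for p
  proof
    assume c: "cycle ?T p"
    let ?n = "length p"
    have n: "?n \<ge> 3" and d: "distinct p" and s: "successively (\<lambda>x y. {x, y} \<in> E) p"
      and l: "{last p, hd p} \<in> E"
      using c by (auto simp: cycle_def walk_def)
    have ne: "p \<noteq> []" using n by auto
    have "finite (rank ` set p)" "rank ` set p \<noteq> {}" using ne by auto
    then have "Max (rank ` set p) \<in> rank ` set p" by (rule Max_in)
    then obtain x where x: "x \<in> set p" "rank x = Max (rank ` set p)" by auto
    then have max: "\<And>y. y \<in> set p \<Longrightarrow> rank y \<le> rank x" by simp
    obtain k where k: "k < ?n" "p ! k = x" using x(1) by (auto simp: in_set_conv_nth)
    \<comment> \<open>The cyclic successor and predecessor of position \<open>k\<close>; they differ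
      because the cycle has at least three vertices.\<close>
    define k1 where "k1 = (if Suc k = ?n then 0 else Suc k)"
    define k2 where "k2 = (if k = 0 then ?n - 1 else k - 1)"
    have less: "k1 < ?n" "k2 < ?n" "k1 \<noteq> k2" using k n by (auto simp: k1_def k2_def)
    have st: "{p ! i, p ! Suc i} \<in> E" if "Suc i < ?n" for i
      using s that by (simp add: successively_conv_nth)
    have l': "{p ! (?n - 1), p ! 0} \<in> E" using l ne by (simp add: last_conv_nth hd_conv_nth)
    have "{x, p ! k1} \<in> E"
    proof (cases "Suc k = ?n")
      case True
      then have "k = ?n - 1" by simp
      then show ?thesis using l' k True by (simp add: k1_def)
    next
      case False
      then show ?thesis using st[of k] k by (simp add: k1_def)
    qed
    moreover have "{x, p ! k2} \<in> E"
    proof (cases "k = 0")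
      case True
      then show ?thesis using l' k by (simp add: k2_def insert_commute)
    next
      case False
      then show ?thesis using st[of "k - 1"] k by (simp add: k2_def insert_commute)
    qed
    ultimately have "p ! k1 = p ! k2"
      using lower max less by (metis nth_mem)
    then show False using d less nth_eq_iff_index_eq by blast
  qed
  then show ?thesis using simple conn by (simp add: is_tree_def)
qed

text \<open>Otherwise the walk contains a path between two different neighbours of \<open>v\<close>
  that avoids \<open>v\<close>, and \<open>v\<close> closes it to a cycle.\<close>

lemma tree_neighbours_separated:
  assumes T: "is_tree G" and e: "{v, u} \<in> edges G" "{v, u'} \<in> edges G"
    and q: "walk G q" "hd q = u" "last q = u'" "v \<notin> set q"
  shows "u = u'"
proof (rule ccontr)
  assume ne: "u \<noteq> u'"
  obtain p where p: "path G u p u'" "set p \<subseteq> set q"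
    using walk_imp_path[OF q(1)] q by auto
  have "v \<in> verts G" using T e by (auto simp: is_tree_def simple_graph_def)
  moreover have "p \<noteq> []" "length p \<noteq> 1"
    using p ne by (auto simp: path_def walk_def length_Suc_conv)
  then have "length p \<ge> 2" by (cases p) (auto simp: Suc_le_eq)
  ultimately have "cycle G (p @ [v])"
    using p q e by (auto simp: cycle_def path_def walk_def successively_append_iff insert_commute)
  then show False using T by (auto simp: is_tree_def)
qed

section \<open>Unique paths and parents in a rooted tree\<close>

lemma path_snocD:
  assumes "path G r (p @ [v]) w" "p \<noteq> []"
  shows "w = v" "path G r p (last p)" "{v, last p} \<in> edges G" "v \<notin> set p"
  using assms by (auto simp: path_def walk_def successively_append_iff insert_commute)

lemma path_snoc:
  assumes "path G r p u" "{u, v} \<in> edges G" "v \<in> verts G" "v \<notin> set p"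
  shows "path G r (p @ [v]) v"
  using assms by (auto simp: path_def walk_def successively_append_iff)

lemma path_singleton: "path G r p r \<Longrightarrow> p = [r]"
  by (cases p) (auto simp: path_def walk_def split: if_splits)

text \<open>Removing the common end \<open>v\<close> leaves two paths from \<open>r\<close> to
  neighbours of \<open>v\<close>. Going back along one and out along the other avoids
  \<open>v\<close>, so these neighbours coincide and induction applies to the shortened
  paths.\<close>

lemma tree_path_unique:
  assumes T: "is_tree G"
  shows "path G r p v \<Longrightarrow> path G r p' v \<Longrightarrow> p = p'"
proof (induction p arbitrary: v p' rule: rev_induct)
  case Nil
  then show ?case by (auto simp: path_def walk_def)
next
  case (snoc x p)
  have xv: "x = v" using snoc.prems by (auto simp: path_def)
  show ?case
  proof (cases "v = r")
    case True
    then show ?thesis using path_singleton snoc.prems by metis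
  next
    case False
    have pne: "p \<noteq> []" using snoc.prems False by (auto simp: path_def)
    obtain q where q: "p' = q @ [v]" using snoc.prems(2)
      by (metis append_butlast_last_id path_def walk_def)
    have qne: "q \<noteq> []" using snoc.prems(2) False q by (auto simp: path_def)
    note P = path_snocD[OF snoc.prems(1) pne]
    note Q = path_snocD[OF snoc.prems(2)[unfolded q] qne]
    have w: "walk G (rev p)" "walk G q" "last (rev p) = hd q"
      using P(2) Q(2) walk_rev by (auto simp: path_def last_rev)
    have "last p = last q"
    proof (rule tree_neighbours_separated[OF T])
      show "{v, last p} \<in> edges G" "{v, last q} \<in> edges G" using P Q xv by auto
      show "walk G (rev p @ tl q)" "hd (rev p @ tl q) = last p" "last (rev p @ tl q) = last q"
        using walk_join[OF w] pne by (auto simp: hd_rev)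
      show "v \<notin> set (rev p @ tl q)"
        using P(4) Q(4) xv qne by (auto dest: list.set_sel(2))
    qed
    then have "p = q" using snoc.IH[OF P(2)] Q(2) by simp
    then show ?thesis using q xv by simp
  qed
qed

lemma tree_rooted:
  assumes T: "is_tree G" and r: "r \<in> verts G"
  obtains P par where
    "\<And>v. v \<in> verts G \<Longrightarrow> path G r (P v) v"
    "\<And>v. v \<in> verts G \<Longrightarrow> v \<noteq> r \<Longrightarrow>
       par v \<in> verts G \<and> {v, par v} \<in> edges G \<and> P v = P (par v) @ [v]"
    "\<And>u v. {u, v} \<in> edges G \<Longrightarrow> u \<noteq> r \<and> v = par u \<or> v \<noteq> r \<and> u = par v"
proof -
  have "\<forall>v\<in>verts G. \<exists>p. path G r p v"
    using T r by (auto simp: is_tree_def connected_graph_def)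
  then obtain P where P: "\<And>v. v \<in> verts G \<Longrightarrow> path G r (P v) v" by metis
  have uniq: "p = P v" if "path G r p v" for p v
  proof -
    have "v \<in> verts G" using that by (auto simp: path_def walk_def)
    then show ?thesis using tree_path_unique[OF T that P] by simp
  qed
  \<comment> \<open>The penultimate vertex of the path from the root; at \<open>r\<close> itself it
    is the unspecified value \<open>last []\<close>.\<close>
  define par where "par v = last (butlast (P v))" for v
  have par: "par v \<in> verts G \<and> {v, par v} \<in> edges G \<and> P v = P (par v) @ [v]"
    if v: "v \<in> verts G" "v \<noteq> r" for v
  proof -
    obtain p where p: "P v = p @ [v]"
      using P[OF v(1)] by (metis append_butlast_last_id path_def walk_def)
    have ne: "p \<noteq> []" using P[OF v(1)] p v by (auto simp: path_def)
    note Q = path_snocD[OF P[OF v(1), unfolded p] ne]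
    have "par v = last p" by (simp add: par_def p)
    moreover have "last p \<in> verts G" using Q(2) ne by (auto simp: path_def walk_def)
    ultimately show ?thesis using Q p uniq by auto
  qed
  have edge: "u \<noteq> r \<and> v = par u \<or> v \<noteq> r \<and> u = par v" if e: "{u, v} \<in> edges G" for u v
  proof -
    have V: "u \<in> verts G" "v \<in> verts G" "u \<noteq> v"
      using e T by (auto simp: is_tree_def simple_graph_def)
    note Pu = P[OF V(1)]
    show ?thesis
    proof (cases "v \<in> set (P u)")
      case False
      have "P v = P u @ [v]" using uniq[OF path_snoc[OF Pu e V(2) False]] by simp
      moreover have "v \<noteq> r" using False Pu by (auto simp: path_def walk_def)
      ultimately show ?thesis using Pu by (auto simp: par_def path_def)
    next
      case True
      then obtain p q where pq: "P u = p @ v # q" by (auto simp: in_set_conv_decomp)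
      \<comment> \<open>The part of \<open>P u\<close> up to \<open>v\<close>, extended by the edge
        to \<open>u\<close>, is again a path to \<open>u\<close>. By uniqueness nothing lies between
        \<open>v\<close> and \<open>u\<close> on \<open>P u\<close>.\<close>
      have pv: "path G r (p @ [v]) v"
        using Pu unfolding pq path_def walk_def
        by (auto simp: successively_append_iff successively_Cons hd_append split: if_splits)
      have u: "u \<notin> set (p @ [v])"
        using Pu V(3) unfolding pq path_def by (auto split: if_splits)
      have "{v, u} \<in> edges G" using e by (simp add: insert_commute)
      from path_snoc[OF pv this V(1) u] have "P u = (p @ [v]) @ [u]" using uniq by simp
      moreover have "u \<noteq> r" using u pv by (auto simp: path_def hd_append split: if_splits)
      ultimately show ?thesis by (simp add: par_def butlast_append)
    qed
  qed
  show thesis using that[OF P par edge] by blast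
qed

section \<open>Rooted trees with an interval on each edge\<close>

text \<open>The edge from \<open>v\<close> to its parent is active exactly during \<open>{a v..b v}\<close>.\<close>

locale interval_tree =
  fixes V :: "'a set" and r :: 'a and par :: "'a \<Rightarrow> 'a" and depth :: "'a \<Rightarrow> nat"
    and a b :: "'a \<Rightarrow> nat" and T :: nat
  assumes finite_V: "finite V" and r_in: "r \<in> V" and T_pos: "1 \<le> T"
    and par_in: "v \<in> V \<Longrightarrow> v \<noteq> r \<Longrightarrow> par v \<in> V"
    and par_depth: "v \<in> V \<Longrightarrow> v \<noteq> r \<Longrightarrow> depth (par v) < depth v"
    and ab: "v \<in> V \<Longrightarrow> v \<noteq> r \<Longrightarrow> 1 \<le> a v \<and> a v \<le> b v \<and> b v \<le> T"
    and sep: "v \<in> V \<Longrightarrow> v \<noteq> r \<Longrightarrow> par v \<noteq> r \<Longrightarrow> b (par v) < a v"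
begin

definition act :: "'a \<Rightarrow> nat \<Rightarrow> bool" where
  "act v t \<longleftrightarrow> v \<noteq> r \<and> a v \<le> t \<and> t \<le> b v"

definition top_at :: "nat \<Rightarrow> 'a \<Rightarrow> 'a" where
  "top_at t v = (if act v t then par v else v)"

text \<open>A node \<open>(v, t)\<close> stands for the star at time \<open>t\<close> with centre \<open>v\<close>.\<close>

definition node_set :: "('a \<times> nat) set" where
  "node_set = {(v, t). v \<in> V \<and> t \<in> {1..T} \<and> \<not> act v t}"

fun node_bag :: "'a \<times> nat \<Rightarrow> 'a set" where
  "node_bag (v, t) = {u \<in> V. top_at t u = v}"

text \<open>Moves one time unit towards the interval of \<open>v\<close>, or towards time 1 at the
  root. A node with \<open>v \<noteq> r\<close> is inactive at \<open>t\<close>, so the last case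
  means that \<open>t\<close> lies before \<open>a v\<close>.\<close>

fun step_time :: "'a \<times> nat \<Rightarrow> nat" where
  "step_time (v, t) = (if v = r \<or> b v < t then t - 1 else t + 1)"

definition node_par :: "'a \<times> nat \<Rightarrow> 'a \<times> nat" where
  "node_par i = (top_at (step_time i) (fst i), step_time i)"

text \<open>For \<open>v \<noteq> r\<close>, the distance of the time of a node from the nearer end
  of the interval of its centre.\<close>

fun time_gap :: "'a \<times> nat \<Rightarrow> nat" where
  "time_gap (v, t) = (if v = r then t else if b v < t then t - b v else a v - t)"

text \<open>Encodes the lexicographic order by depth of the centre, then gap: the gap of a node is
  at most \<open>T\<close>, so one unit of depth outweighs it.\<close>

definition node_rank :: "'a \<times> nat \<Rightarrow> nat" where
  "node_rank i = depth (fst i) * (T + 1) + time_gap i"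

section \<open>Stars at a fixed time\<close>

lemma top_at_in: "v \<in> V \<Longrightarrow> top_at t v \<in> V"
  using par_in by (auto simp: top_at_def act_def)

text \<open>By \<open>sep\<close> the interval of the parent is over before that of \<open>v\<close>
  begins. This makes the components stars, so that \<open>top_at\<close> needs to climb only one
  edge.\<close>

lemma not_act_par: "v \<in> V \<Longrightarrow> act v t \<Longrightarrow> \<not> act (par v) t"
  using sep by (force simp: act_def)

lemma not_act_top: "v \<in> V \<Longrightarrow> \<not> act (top_at t v) t"
  using not_act_par by (auto simp: top_at_def)

lemma top_node: "v \<in> V \<Longrightarrow> t \<in> {1..T} \<Longrightarrow> (top_at t v, t) \<in> node_set"
  using top_at_in not_act_top by (auto simp: node_set_def)

lemma finite_node_set: "finite node_set"
  by (rule finite_subset[of _ "V \<times> {1..T}"]) (auto simp: node_set_def finite_V)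

lemma root_node: "(r, 1) \<in> node_set"
  using r_in T_pos by (auto simp: node_set_def act_def)

section \<open>The parent function on the bags\<close>

lemma node_nonroot:
  assumes "(v, t) \<in> node_set" "v \<noteq> r"
  shows "b v < t \<and> 1 \<le> b v \<or> t < a v \<and> a v \<le> T \<and> t \<le> b v"
  using assms ab[of v] by (auto simp: node_set_def act_def)

lemma node_par:
  assumes i: "i \<in> node_set" "i \<noteq> (r, 1)"
  shows "node_par i \<in> node_set" "node_rank (node_par i) < node_rank i"
    "node_bag i \<inter> node_bag (node_par i) \<noteq> {}"
    "snd i = snd (node_par i) + 1 \<or> snd (node_par i) = snd i + 1"
proof -
  obtain v t where vt: "i = (v, t)" by force
  let ?s = "step_time i"
  have v: "v \<in> V" "t \<in> {1..T}" "\<not> act v t" using i by (auto simp: vt node_set_def)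
  have s: "?s \<in> {1..T}" "t = ?s + 1 \<or> ?s = t + 1"
    using i v node_nonroot[of v t] by (auto simp: vt)
  show "node_par i \<in> node_set" using top_node[OF v(1) s(1)] by (simp add: node_par_def vt)
  show "snd i = snd (node_par i) + 1 \<or> snd (node_par i) = snd i + 1"
    using s by (simp add: node_par_def vt)
  \<comment> \<open>The old centre belongs to both bags, even when its parent becomes the new
    centre.\<close>
  have "v \<in> node_bag i \<inter> node_bag (node_par i)"
    using v by (simp add: vt node_par_def top_at_def)
  then show "node_bag i \<inter> node_bag (node_par i) \<noteq> {}" by blast
  show "node_rank (node_par i) < node_rank i"
  proof (cases "act v ?s")
    case True
    then have "v \<noteq> r" by (simp add: act_def)
    then have "Suc (depth (par v)) \<le> depth v" using par_depth v by (simp add: Suc_le_eq)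
    then have "depth (par v) * (T + 1) + (T + 1) \<le> depth v * (T + 1)"
      by (metis add.commute mult_Suc mult_le_mono1)
    moreover have "time_gap (par v, ?s) \<le> T"
      using s(1) node_nonroot[OF top_node[OF v(1) s(1)]] True
      by (auto simp: top_at_def)
    ultimately show ?thesis using True
      by (simp add: node_par_def vt node_rank_def top_at_def)
  next
    case False
    have "time_gap (v, ?s) < time_gap (v, t)"
    proof (cases "v = r")
      case True
      then show ?thesis using v vt by simp
    next
      case nr: False
      show ?thesis
      proof (cases "b v < t")
        case True
        \<comment> \<open>After the step \<open>v\<close> is still inactive, so its interval has not
          been reached and both gaps are measured to the same end of it.\<close>
        then have "\<not> a v \<le> t - 1 \<or> b v < t - 1"
          using False nr vt by (auto simp: act_def)
        then show ?thesis using True nr vt ab[OF v(1) nr] by simp linarith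
      next
        case late: False
        then have "t < a v" using node_nonroot i nr vt by blast
        moreover have "\<not> a v \<le> t + 1 \<or> b v < t + 1"
          using False nr late vt by (auto simp: act_def)
        ultimately show ?thesis using late nr vt ab[OF v(1) nr] by simp
      qed
    qed
    then show ?thesis using False by (simp add: node_par_def vt node_rank_def top_at_def)
  qed
qed

text \<open>For \<open>v \<noteq> r\<close>, both times lie on the same side of the interval of
  \<open>v\<close>. After it the later node steps back to the earlier one; before it the earlier
  node steps forward. The root always steps back.\<close>

lemma consecutive_tops:
  assumes v: "v \<in> V" "\<not> act v t" "\<not> act v (t + 1)" "1 \<le> t"
  shows "node_par (v, t) = (v, t + 1) \<or> (v, t + 1) \<noteq> (r, 1) \<and> node_par (v, t + 1) = (v, t)"
proof (cases "v = r \<or> b v < t + 1")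
  case True
  then show ?thesis using v by (auto simp: node_par_def top_at_def)
next
  case False
  then show ?thesis using v ab[of v] by (auto simp: node_par_def top_at_def)
qed

text \<open>Let \<open>u\<close> be a common vertex. If it is attached to its parent at both times
  or at neither, the centre persists. If it is attached at exactly one of them, it is the centre of
  the other bag, whose step leads to the time of attachment.\<close>

lemma arc_imp_node_par:
  assumes i: "i \<in> node_set" and j: "j \<in> node_set"
    and meet: "node_bag i \<inter> node_bag j \<noteq> {}" and next_time: "snd j = snd i + 1"
  shows "i \<noteq> (r, 1) \<and> j = node_par i \<or> j \<noteq> (r, 1) \<and> i = node_par j"
proof -
  obtain u where u: "u \<in> V" "u \<in> node_bag i" "u \<in> node_bag j"
    using meet by (cases i; cases j) auto
  define t where "t = snd i"
  have ij: "i = (top_at t u, t)" "j = (top_at (t + 1) u, t + 1)"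
    using u next_time by (cases i; cases j; auto simp: t_def)+
  have t: "1 \<le> t" "t + 1 \<le> T" using i j by (auto simp: ij node_set_def)
  have na: "\<not> act (top_at t u) t" "\<not> act (top_at (t + 1) u) (t + 1)"
    using not_act_top u(1) by auto
  \<comment> \<open>The step from \<open>(r, 1)\<close> leads to time 0, whereas \<open>j\<close>
    has time at least 2.\<close>
  have r: "j \<noteq> (r, 1)" "i = (r, 1) \<Longrightarrow> j \<noteq> node_par i"
    using t by (auto simp: ij node_par_def)
  have "j = node_par i \<or> j \<noteq> (r, 1) \<and> i = node_par j"
  proof (cases "act u t \<longleftrightarrow> act u (t + 1)")
    case True
    then have e: "top_at (t + 1) u = top_at t u" by (simp add: top_at_def)
    show ?thesis
      using consecutive_tops[OF top_at_in[OF u(1)], of t t] na t e ij by auto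
  next
    case False
    then have u_r: "u \<noteq> r" by (auto simp: act_def)
    show ?thesis
    proof (cases "act u t")
      case True
      then have "\<not> act u (t + 1)" "b u < t + 1" using False u_r by (auto simp: act_def)
      then show ?thesis using u_r by (simp add: ij node_par_def top_at_def)
    next
      case nact: False
      then have "act u (t + 1)" "\<not> b u < t" using False u_r by (auto simp: act_def)
      then show ?thesis using u_r nact by (simp add: ij node_par_def top_at_def)
    qed
  qed
  then show ?thesis using r by blast
qed

text \<open>The set on the right represents each edge at \<open>v\<close> active at time
  \<open>t\<close> by its lower end, so it counts the degree of \<open>v\<close>. As the centre is
  inactive, these lower ends are the leaves of its star; the centre adds 1.\<close>

lemma card_node_bag:
  assumes "(v, t) \<in> node_set"
  shows "card (node_bag (v, t)) = card {u \<in> V. act u t \<and> (u = v \<or> par u = v)} + 1"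
proof -
  have v: "v \<in> V" "\<not> act v t" using assms by (auto simp: node_set_def)
  have "node_bag (v, t) = insert v {u \<in> V. act u t \<and> (u = v \<or> par u = v)}"
    using v by (auto simp: top_at_def)
  then show ?thesis using v finite_V by simp
qed

text \<open>A vertex that is not the top of its star is a leaf of it, so its degree is dominated by that
  of the centre.\<close>

lemma Max_card_node_bag:
  "(MAX i\<in>node_set. card (node_bag i)) =
   (MAX t\<in>{1..T}. MAX v\<in>V. card {u \<in> V. act u t \<and> (u = v \<or> par u = v)}) + 1"
  (is "?L = (MAX t\<in>_. MAX v\<in>_. ?d t v) + 1")
proof (rule antisym)
  let ?R = "MAX t\<in>{1..T}. MAX v\<in>V. ?d t v"
  have le_R: "?d t v \<le> ?R" if "t \<in> {1..T}" "v \<in> V" for t v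
  proof -
    have "?d t v \<le> (MAX v\<in>V. ?d t v)" using that finite_V by (intro Max_ge) auto
    also have "\<dots> \<le> ?R" using that by (intro Max_ge) auto
    finally show ?thesis .
  qed
  have "card (node_bag i) \<le> ?R + 1" if i: "i \<in> node_set" for i
  proof -
    obtain v t where vt: "i = (v, t)" by force
    then have "v \<in> V" "t \<in> {1..T}" using i by (auto simp: node_set_def)
    then show ?thesis using le_R card_node_bag i vt by simp
  qed
  then show "?L \<le> ?R + 1"
    using finite_node_set root_node by (subst Max_le_iff) auto
  have "?d t v + 1 \<le> ?L" if tv: "t \<in> {1..T}" "v \<in> V" for t v
  proof -
    have "?d t v \<le> ?d t (top_at t v)"
    proof (cases "act v t")
      case True
      then have "{u \<in> V. act u t \<and> (u = v \<or> par u = v)} \<subseteq> {v}"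
        using not_act_par by auto
      then have "?d t v \<le> card {v}" by (intro card_mono) auto
      then have "?d t v \<le> 1" by simp
      moreover have "v \<in> {u \<in> V. act u t \<and> (u = top_at t v \<or> par u = top_at t v)}"
        using True tv by (simp add: top_at_def)
      then have "1 \<le> ?d t (top_at t v)"
        using finite_V by (auto simp: Suc_le_eq card_gt_0_iff)
      ultimately show ?thesis by simp
    qed (simp add: top_at_def)
    then have "?d t v + 1 \<le> card (node_bag (top_at t v, t))"
      using card_node_bag[OF top_node[OF tv(2,1)]] by simp
    also have "\<dots> \<le> ?L" using top_node[OF tv(2,1)] finite_node_set
      by (intro Max_ge finite_imageI imageI)
    finally show ?thesis .
  qed
  then have "(MAX v\<in>V. ?d t v) \<le> ?L - 1" if "t \<in> {1..T}" for t
    using that finite_V r_in by (subst Max_le_iff) (auto simp: le_diff_conv2 add_le_imp_le_diff)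
  then have "?R \<le> ?L - 1" using T_pos by (subst Max_le_iff) auto
  \<comment> \<open>Subtraction is truncated, so this is needed to move the 1 back across the
    inequality.\<close>
  moreover have "1 \<le> ?L"
    using \<open>\<And>v t. t \<in> {1..T} \<Longrightarrow> v \<in> V \<Longrightarrow> ?d t v + 1 \<le> ?L\<close>[of 1 r] T_pos r_in by simp
  ultimately show "?R + 1 \<le> ?L" by linarith
qed

end

section \<open>Temporal trees\<close>

text \<open>The extreme times are labels already, and every time strictly between them is added, so
  the label set becomes its convex hull.\<close>

lemma label_fill_gaps:
  assumes "temporal_graph G" "e \<in> edges G"
  shows "label (fill_gaps G) e = {Min (label G e)..Max (label G e)}"
    "1 \<le> Min (label G e)" "Min (label G e) \<le> Max (label G e)"
    "Max (label G e) \<le> lifetime G"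
proof -
  let ?L = "label G e"
  have L: "finite ?L" "?L \<noteq> {}" "0 \<notin> ?L" using assms by (auto simp: temporal_graph_def)
  have M: "Min ?L \<in> ?L" "Max ?L \<in> ?L" using L by auto
  show "1 \<le> Min ?L" using M L by (metis One_nat_def Suc_leI gr0I)
  show "Min ?L \<le> Max ?L" using M L by simp
  show "label (fill_gaps G) e = {Min ?L..Max ?L}"
  proof (intro equalityI subsetI)
    fix t assume "t \<in> label (fill_gaps G) e"
    then obtain t1 t2 where "t1 \<le> t" "t \<le> t2" "t1 \<in> ?L" "t2 \<in> ?L"
      by (auto simp: fill_gaps_def time_edge_def) (use less_imp_le in blast)
    then show "t \<in> {Min ?L..Max ?L}"
      using L Min_le[of ?L t1] Max_ge[of ?L t2] by (meson atLeastAtMost_iff order_trans)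
  next
    fix t assume t: "t \<in> {Min ?L..Max ?L}"
    show "t \<in> label (fill_gaps G) e"
    proof (cases "t = Min ?L \<or> t = Max ?L")
      case True
      then show ?thesis using M by (auto simp: fill_gaps_def)
    next
      case False
      then have "Min ?L < t" "t < Max ?L" using t by auto
      then show ?thesis using M assms(2) unfolding fill_gaps_def time_edge_def by auto
    qed
  qed
  have "finite (verts G)" "edges G \<subseteq> Pow (verts G)"
    using assms by (auto simp: temporal_graph_def simple_graph_def)
  then have "finite (edges G)" using finite_subset by blast
  then show "Max ?L \<le> lifetime G" unfolding lifetime_def using assms(2) by (intro Max_ge) auto
qed

theorem mainTheorem13:
  fixes G :: "'a tgraph"
  assumes "temporal_graph G"
    and "is_tree G"
    and "\<exists>r\<in>verts G. incident_edges_first G r"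
  shows "\<exists>D :: (nat, 'a) tim. tim_decomposition G D \<and>
    tim_width D =
      (MAX t\<in>{1..lifetime G}. MAX v\<in>verts G. degree (snapshot (fill_gaps G) t) v) + 1"
proof -

  \<comment> \<open>Rooting the tree and separating the intervals\<close>
  obtain r where r: "r \<in> verts G" and first: "incident_edges_first G r" using assms(3) by blast
  obtain P par where P: "\<And>v. v \<in> verts G \<Longrightarrow> path G r (P v) v"
    and par: "\<And>v. v \<in> verts G \<Longrightarrow> v \<noteq> r \<Longrightarrow>
       par v \<in> verts G \<and> {v, par v} \<in> edges G \<and> P v = P (par v) @ [v]"
    and edge: "\<And>u v. {u, v} \<in> edges G \<Longrightarrow> u \<noteq> r \<and> v = par u \<or> v \<noteq> r \<and> u = par v"
    by (rule tree_rooted[OF assms(2) r]) blast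
  define a where "a v = Min (label G {v, par v})" for v
  define b where "b v = Max (label G {v, par v})" for v
  have simple: "finite (verts G)" "\<And>e. e \<in> edges G \<Longrightarrow> e \<subseteq> verts G \<and> card e = 2"
    using assms(1) by (auto simp: temporal_graph_def simple_graph_def)
  have sep: "b (par v) < a v" if v: "v \<in> verts G" "v \<noteq> r" "par v \<noteq> r" for v
  proof -
    \<comment> \<open>The hypothesis is applied at the grandparent \<open>?x\<close>: there the edge
      from \<open>?w\<close> to \<open>?x\<close> is incident, while the edge from \<open>v\<close>
      to \<open>?w\<close> lies in the subtree without being incident.\<close>
    let ?w = "par v" let ?x = "par (par v)"
    have w: "?w \<in> verts G" "{v, ?w} \<in> edges G" "P v = P ?w @ [v]" using par v by auto
    have x: "?x \<in> verts G" "{?w, ?x} \<in> edges G" "P ?w = P ?x @ [?w]" using par v w by auto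
    have "?x \<in> set (P ?x)" using P[OF x(1)] by (metis last_in_set path_def walk_def)
    then have "v \<in> subtree_verts G r ?x" "?w \<in> subtree_verts G r ?x"
      unfolding subtree_verts_def using P[OF v(1)] P[OF w(1)] w(3) x(3)
      by (metis (mono_tags, lifting) Un_iff mem_Collect_eq set_append)+
    then have f: "{v, ?w} \<in> subtree_edges G r ?x" using w(2) by (simp add: subtree_edges_def)
    have "length (P ?x) \<noteq> length (P v)" "length (P ?x) \<noteq> length (P ?w)"
      using arg_cong[OF w(3), of length] arg_cong[OF x(3), of length] by simp_all
    then have "?x \<in> {?w, ?x} \<and> ?x \<notin> {v, ?w}" by (metis empty_iff insert_iff)
    note first[unfolded incident_edges_first_def, rule_format, OF x(1,2) f this]
    moreover have "finite (label G e) \<and> label G e \<noteq> {}" if "e \<in> edges G" for e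
      using that assms(1) by (auto simp: temporal_graph_def)
    ultimately show ?thesis using x w by (simp add: a_def b_def)
  qed
  obtain e0 where e0: "e0 \<in> edges G" using assms(1) by (auto simp: temporal_graph_def)
  have interval: "1 \<le> a v \<and> a v \<le> b v \<and> b v \<le> lifetime G \<and>
      label (fill_gaps G) {v, par v} = {a v..b v}" if "v \<in> verts G" "v \<noteq> r" for v
    using label_fill_gaps[OF assms(1)] par[OF that] by (simp add: a_def b_def)
  have "1 \<le> lifetime G" using label_fill_gaps(2-4)[OF assms(1) e0] by linarith
  then interpret interval_tree "verts G" r par "\<lambda>v. length (P v)" a b "lifetime G"
    using simple r par interval sep by unfold_locales auto

  \<comment> \<open>Degrees in the snapshots of the filled graph\<close>
  have edges_eq: "edges G = (\<lambda>v. {v, par v}) ` (verts G - {r})"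
  proof (intro equalityI subsetI)
    fix e assume e: "e \<in> edges G"
    then obtain u v where uv: "e = {u, v}" using simple(2) card_2_iff by metis
    then have "u \<in> verts G" "v \<in> verts G" using e simple(2) by auto
    then show "e \<in> (\<lambda>v. {v, par v}) ` (verts G - {r})" using edge e uv by blast
  qed (use par in auto)
  \<comment> \<open>Distinct vertices with the same edge would be parents of each other,
    contradicting the decrease of depth.\<close>
  have inj: "inj_on (\<lambda>v. {v, par v}) (verts G - {r})"
  proof (rule inj_onI)
    fix u v assume "u \<in> verts G - {r}" "v \<in> verts G - {r}" "{u, par u} = {v, par v}"
    then show "u = v" using par_depth[of u] par_depth[of v] by (auto simp: doubleton_eq_iff)
  qed
  have degree: "degree (snapshot (fill_gaps G) t) v =
      card {u \<in> verts G. act u t \<and> (u = v \<or> par u = v)}" for t v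
  proof -
    have "{e \<in> edges (snapshot (fill_gaps G) t). v \<in> e} =
        {e \<in> edges G. t \<in> label (fill_gaps G) e \<and> v \<in> e}"
      by (auto simp: snapshot_def time_edge_def fill_gaps_def)
    also have "\<dots> = (\<lambda>v. {v, par v}) `
        {u \<in> verts G - {r}. t \<in> label (fill_gaps G) {u, par u} \<and> v \<in> {u, par u}}"
      unfolding edges_eq by blast
    also have "{u \<in> verts G - {r}. t \<in> label (fill_gaps G) {u, par u} \<and> v \<in> {u, par u}} =
        {u \<in> verts G. act u t \<and> (u = v \<or> par u = v)}"
      using interval unfolding act_def by fastforce
    finally have "degree (snapshot (fill_gaps G) t) v =
        card ((\<lambda>v. {v, par v}) ` {u \<in> verts G. act u t \<and> (u = v \<or> par u = v)})"
      by (simp add: degree_def)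
    also have "\<dots> = card {u \<in> verts G. act u t \<and> (u = v \<or> par u = v)}"
      by (rule card_image, rule inj_on_subset[OF inj]) (auto simp: act_def)
    finally show ?thesis .
  qed

  \<comment> \<open>The nodes of \<open>D\<close> are natural numbers, so the pairs in
    \<open>node_set\<close> are numbered by \<open>h\<close>, with inverse \<open>g\<close>.\<close>
  obtain h where h: "bij_betw h {0..<card node_set} node_set"
    using ex_bij_betw_nat_finite[OF finite_node_set] by blast
  let ?I = "{0..<card node_set}"
  define g where "g = inv_into ?I h"
  have h_in: "\<And>i. i \<in> ?I \<Longrightarrow> h i \<in> node_set" using h by (auto simp: bij_betw_def)
  have g_in: "\<And>x. x \<in> node_set \<Longrightarrow> g x \<in> ?I"
    using h unfolding g_def bij_betw_def by (metis inv_into_into)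
  have hg: "\<And>x. x \<in> node_set \<Longrightarrow> h (g x) = x"
    using h unfolding g_def by (meson bij_betw_inv_into_right)
  have gh: "\<And>i. i \<in> ?I \<Longrightarrow> g (h i) = i"
    using h unfolding g_def by (meson bij_betw_inv_into_left)
  define A where "A = {(i, j). i \<in> ?I \<and> j \<in> ?I \<and>
    node_bag (h i) \<inter> node_bag (h j) \<noteq> {} \<and> snd (h j) = snd (h i) + 1}"
  define D where "D = \<lparr>nodes = ?I, arcs = A, bag = \<lambda>i. node_bag (h i), time = \<lambda>i. snd (h i)\<rparr>"

  \<comment> \<open>The graph of bags is a directed tree\<close>
  have root: "\<And>i. i \<in> ?I \<Longrightarrow> i \<noteq> g (r, 1) \<longleftrightarrow> h i \<noteq> (r, 1)"
    using gh hg root_node by metis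
  have "is_tree \<lparr>verts = ?I, edges = {{i, j} |i j. (i, j) \<in> A}\<rparr>"
  proof (rule is_tree_parentI[where z = "g (r, 1)" and par = "\<lambda>i. g (node_par (h i))"
        and rank = "\<lambda>i. node_rank (h i)"])
    show "finite ?I" "g (r, 1) \<in> ?I" using g_in root_node by auto
    fix i assume "i \<in> ?I" "i \<noteq> g (r, 1)"
    then show "g (node_par (h i)) \<in> ?I \<and> node_rank (h (g (node_par (h i)))) < node_rank (h i)"
      using root node_par(1,2)[of "h i"] h_in g_in hg by auto
  next
    show "{{i, j} |i j. (i, j) \<in> A} = {{i, g (node_par (h i))} |i. i \<in> ?I \<and> i \<noteq> g (r, 1)}"
    proof (intro equalityI subsetI)
      fix e assume "e \<in> {{i, j} |i j. (i, j) \<in> A}"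
      then obtain i j where ij: "e = {i, j}" "(i, j) \<in> A" by blast
      then have I: "i \<in> ?I" "j \<in> ?I" by (auto simp: A_def)
      have "h i \<noteq> (r, 1) \<and> h j = node_par (h i) \<or> h j \<noteq> (r, 1) \<and> h i = node_par (h j)"
        using ij h_in by (intro arc_imp_node_par) (auto simp: A_def)
      then have "i \<noteq> g (r, 1) \<and> j = g (node_par (h i)) \<or> j \<noteq> g (r, 1) \<and> i = g (node_par (h j))"
        using I root gh by metis
      then show "e \<in> {{i, g (node_par (h i))} |i. i \<in> ?I \<and> i \<noteq> g (r, 1)}"
        using I ij(1) by blast
    next
      fix e assume "e \<in> {{i, g (node_par (h i))} |i. i \<in> ?I \<and> i \<noteq> g (r, 1)}"
      then obtain i where i: "e = {i, g (node_par (h i))}" "i \<in> ?I" "h i \<noteq> (r, 1)"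
        using root by auto
      note N = node_par[OF h_in[OF i(2)] i(3)]
      \<comment> \<open>Arcs point forward in time, but the parent may be the earlier or the later
        bag.\<close>
      have "(i, g (node_par (h i))) \<in> A \<or> (g (node_par (h i)), i) \<in> A"
        using N(4)
      proof
        assume "snd (h i) = snd (node_par (h i)) + 1"
        then have "(g (node_par (h i)), i) \<in> A"
          using N(3) hg[OF N(1)] g_in[OF N(1)] i(2) unfolding A_def
          by (simp add: Int_commute)
        then show ?thesis ..
      next
        assume "snd (node_par (h i)) = snd (h i) + 1"
        then have "(i, g (node_par (h i))) \<in> A"
          using N(3) hg[OF N(1)] g_in[OF N(1)] i(2) unfolding A_def by simp
        then show ?thesis ..
      qed
      then show "e \<in> {{i, j} |i j. (i, j) \<in> A}" using i(1) insert_commute by blast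
    qed
  qed
  moreover have "A \<inter> A\<inverse> = {}" by (auto simp: A_def)
  ultimately have tree: "directed_tree ?I A" by (simp add: directed_tree_def)

  \<comment> \<open>Unique bags for vertices and time-edges\<close>
  have bag_iff: "v \<in> node_bag (h i) \<and> snd (h i) = t \<longleftrightarrow> i = g (top_at t v, t)"
    if "v \<in> verts G" "t \<in> {1..lifetime G}" "i \<in> ?I" for v t i
  proof -
    have "v \<in> node_bag (h i) \<and> snd (h i) = t \<longleftrightarrow> h i = (top_at t v, t)"
      using that by (cases "h i") auto
    also have "\<dots> \<longleftrightarrow> i = g (top_at t v, t)"
      using gh hg top_node that by metis
    finally show ?thesis .
  qed
  have uniq: "\<exists>!i. i \<in> ?I \<and> v \<in> node_bag (h i) \<and> snd (h i) = t"
    if "v \<in> verts G" "t \<in> {1..lifetime G}" for v t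
    using bag_iff[OF that] g_in[OF top_node[OF that]] by blast
  have edge_bag: "\<exists>!i. i \<in> ?I \<and> {u, v} \<subseteq> node_bag (h i) \<and> snd (h i) = t"
    if te: "time_edge G {u, v} t" for u v t
  proof -
    have e: "{u, v} \<in> edges G" "t \<in> label (fill_gaps G) {u, v}"
      using te by (auto simp: time_edge_def fill_gaps_def)
    then have uv: "u \<in> verts G" "v \<in> verts G" using simple(2) by auto
    have t: "t \<in> {1..lifetime G}"
      using label_fill_gaps[OF assms(1) e(1)] e(2) by auto
    \<comment> \<open>The upper end of an active edge is its own centre by
      \<open>not_act_par\<close>, and the lower end has the upper one as centre.\<close>
    have "top_at t u = top_at t v"
      using edge[OF e(1)]
    proof (elim disjE conjE)
      assume "u \<noteq> r" "v = par u"
      then have "act u t" using interval e uv by (simp add: act_def)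
      then show ?thesis using not_act_par uv \<open>v = par u\<close> by (auto simp: top_at_def)
    next
      assume "v \<noteq> r" "u = par v"
      then have "act v t" using interval[of v] e uv by (simp add: act_def insert_commute)
      then show ?thesis using not_act_par uv \<open>u = par v\<close> by (auto simp: top_at_def)
    qed
    then show ?thesis
      using bag_iff[OF uv(1) t] bag_iff[OF uv(2) t] g_in[OF top_node[OF uv(1) t]] by auto
  qed
  have range: "node_bag (h i) \<subseteq> verts G \<and> snd (h i) \<in> {1..lifetime G}" if "i \<in> ?I" for i
    using h_in[OF that] by (cases "h i") (auto simp: node_set_def)
  have "tim_decomposition G D"
    unfolding tim_decomposition_def D_def tim.simps
    by (intro conjI allI ballI impI tree range uniq edge_bag A_def)
  moreover have "tim_width D = (MAX i\<in>node_set. card (node_bag i))"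
  proof -
    have "(\<lambda>i. card (node_bag (h i))) ` ?I = (\<lambda>i. card (node_bag i)) ` node_set"
      using bij_betw_imp_surj_on[OF h] by (metis image_image)
    then show ?thesis by (simp add: tim_width_def D_def)
  qed
  ultimately show ?thesis using Max_card_node_bag degree by auto
qed

end
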